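(* Let $X=\mathbb{R}^n$, $\mathbb{U}\subseteq\mathbb{R}^m$, $f:X\times\mathbb{U}\to X$, $\ell:X\times\mathbb{U}\to\mathbb{R}_{\ge0}$, $\sigma:X\to\mathbb{R}_{\ge0}$. Consider the terminal cost $V_{\mathrm{f}}(x)=\omega\sigma(x)$ with some $\omega>0$, and suppose there exist constants $\overline\gamma_{\mathrm{f}}\ge0$, $\gamma_{k,\mathrm{f}}\in[0,\overline\gamma_{\mathrm{f}}]$, $k\in\mathbb{I}_{\ge1}$, such that $V_{k,\mathrm{f}}(x)\le\gamma_{k,\mathrm{f}}\sigma(x)$ for all $x\in X$ and $k\in\mathbb{I}_{\ge1}$. Then the following terminal cost condition holds with $\underline c_{\mathrm{f}}=\overline c_{\mathrm{f}}=\omega$ and $1+\epsilon_{\mathrm{f}}=\gamma_{1,\mathrm{f}}/\omega$: the constants satisfy $\underline c_{\mathrm{f}},\overline c_{\mathrm{f}},\epsilon_{\mathrm{f}}>0$ and, for any $x\in X$, $$\underline c_{\mathrm{f}}\sigma(x)\le V_{\mathrm{f}}(x)\le\overline c_{\mathrm{f}}\sigma(x),\qquad \min_{u\in\mathbb{U}}\{V_{\mathrm{f}}(f(x,u))+\ell(x,u)\}\le(1+\epsilon_{\mathrm{f}})V_{\mathrm{f}}(x),\qquad \underline c_{\mathrm{f}}\le\frac{\gamma_{1,\mathrm{f}}}{1+\epsilon_{\mathrm{f}}}\le\overline c_{\mathrm{f}}.$$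
   Context: $\mathbb{I}_{\ge a}$ denotes the integers $\ge a$. System $x(k+1)=f(x(k),u(k))$; $x_u(k,x)$ is the state after $k$ steps under the input sequence $u$ starting from $x_u(0,x)=x$. $V_{k,\mathrm{f}}(x)=\inf_{u\in\mathbb{U}^k}\left\{\sum_{j=0}^{k-1}\ell(x_u(j,x),u(j))+V_{\mathrm{f}}(x_u(k,x))\right\}$. Minimizers of these problems are assumed to exist.
   Formalization: Positivity of ε_f is concluded only if γ_{1,f} > ω, to which it is equivalent (with ℓ=0, f(x,u)=x, γ_{k,f}=ω one gets ε_f=0), and the bounds on γ_{1,f}/(1+ε_f) only if γ_{1,f} > 0, as otherwise the quotient is 0/0; the rest is unconditional. *)

theory Defs
  imports "HOL-Analysis.Analysis"
begin

primrec traj :: "('x \<Rightarrow> 'u \<Rightarrow> 'x) \<Rightarrow> (nat \<Rightarrow> 'u) \<Rightarrow> nat \<Rightarrow> 'x \<Rightarrow> 'x" where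
  "traj f u 0 x = x"
| "traj f u (Suc k) x = f (traj f u k x) (u k)"

definition horizon_cost ::
  "('x \<Rightarrow> 'u \<Rightarrow> 'x) \<Rightarrow> ('x \<Rightarrow> 'u \<Rightarrow> real) \<Rightarrow> ('x \<Rightarrow> real) \<Rightarrow> nat \<Rightarrow> 'x \<Rightarrow> (nat \<Rightarrow> 'u) \<Rightarrow> real" where
  "horizon_cost f l Vf k x u = (\<Sum>j<k. l (traj f u j x) (u j)) + Vf (traj f u k x)"

text \<open>
  The set of input sequences of length \<open>k\<close> with values in \<open>U\<close> is \<open>{..<k} \<rightarrow>\<^sub>E U\<close>.
  The infimum below is the conditionally complete one on the reals: it is the mathematical
  infimum as soon as \<open>U\<close> is nonempty and the stage and terminal costs are nonnegative.
\<close>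

definition value_fun ::
  "'u set \<Rightarrow> ('x \<Rightarrow> 'u \<Rightarrow> 'x) \<Rightarrow> ('x \<Rightarrow> 'u \<Rightarrow> real) \<Rightarrow> ('x \<Rightarrow> real) \<Rightarrow> nat \<Rightarrow> 'x \<Rightarrow> real" where
  "value_fun U f l Vf k x = (INF u \<in> {..<k} \<rightarrow>\<^sub>E U. horizon_cost f l Vf k x u)"

definition minimizers_exist ::
  "'u set \<Rightarrow> ('x \<Rightarrow> 'u \<Rightarrow> 'x) \<Rightarrow> ('x \<Rightarrow> 'u \<Rightarrow> real) \<Rightarrow> ('x \<Rightarrow> real) \<Rightarrow> bool" where
  "minimizers_exist U f l Vf \<longleftrightarrow>
    (\<forall>k\<ge>1. \<forall>x. \<exists>u. is_arg_min (horizon_cost f l Vf k x) (\<lambda>u. u \<in> {..<k} \<rightarrow>\<^sub>E U) u)"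

text \<open>
  The inequality between the minimum over \<open>U\<close> of \<open>Vf (f x u) + l x u\<close> and
  \<open>(1 + \<epsilon>) * Vf x\<close> includes the claim that the minimum is attained.
\<close>

definition one_step_bound ::
  "'u set \<Rightarrow> ('x \<Rightarrow> 'u \<Rightarrow> 'x) \<Rightarrow> ('x \<Rightarrow> 'u \<Rightarrow> real) \<Rightarrow> ('x \<Rightarrow> real) \<Rightarrow> real \<Rightarrow> bool" where
  "one_step_bound U f l Vf \<epsilon> \<longleftrightarrow>
    (\<forall>x. \<exists>u. is_arg_min (\<lambda>u. Vf (f x u) + l x u) (\<lambda>u. u \<in> U) u \<and>
             Vf (f x u) + l x u \<le> (1 + \<epsilon>) * Vf x)"

definition terminal_cost_condition ::
  "'u set \<Rightarrow> ('x \<Rightarrow> 'u \<Rightarrow> 'x) \<Rightarrow> ('x \<Rightarrow> 'u \<Rightarrow> real) \<Rightarrow> ('x \<Rightarrow> real) \<Rightarrow> ('x \<Rightarrow> real)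
     \<Rightarrow> real \<Rightarrow> real \<Rightarrow> real \<Rightarrow> real \<Rightarrow> bool" where
  "terminal_cost_condition U f l \<sigma> Vf \<gamma>1 cl cu \<epsilon> \<longleftrightarrow>
     0 < cl \<and> 0 < cu \<and> 0 < \<epsilon> \<and>
     (\<forall>x. cl * \<sigma> x \<le> Vf x \<and> Vf x \<le> cu * \<sigma> x) \<and>
     one_step_bound U f l Vf \<epsilon> \<and>
     cl \<le> \<gamma>1 / (1 + \<epsilon>) \<and> \<gamma>1 / (1 + \<epsilon>) \<le> cu"

end

theory Submission
  imports Defs
begin

text \<open>
  With a terminal cost \<open>\<omega> * \<sigma>\<close>, the one-step inequality is the value bound at horizon one in
  disguise. An input sequence of length one is a single input \<open>v\<close>, and its cost is
  \<open>l x v + Vf (f x v)\<close>. So a minimizer of the horizon-one problem yields a minimizer over \<open>U\<close>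
  (\<open>arg_min_horizon_one\<close>), its cost is the value function (\<open>value_fun_eq_arg_min\<close>), and the
  latter is at most \<open>\<gamma> 1 * \<sigma> x\<close>, which equals \<open>(\<gamma> 1 / \<omega>) * Vf x = (1 + \<epsilon>) * Vf x\<close>.
  The sandwich for \<open>Vf\<close> is an equality, and so is the one for \<open>\<gamma> 1 / (1 + \<epsilon>)\<close>:
  when \<open>\<gamma> 1\<close> is positive this quotient is \<open>\<omega>\<close>. Finally, \<open>\<epsilon> > 0\<close> amounts to \<open>\<omega> < \<gamma> 1\<close>.
\<close>

lemma horizon_cost_one: "horizon_cost f l Vf 1 x u = Vf (f x (u 0)) + l x (u 0)"
  by (simp add: horizon_cost_def)

text \<open>
  Attainment makes the infimum over the reals genuine: the minimal cost is itself a lower bound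
  of the set of costs, which is therefore nonempty and bounded below.
\<close>

lemma value_fun_eq_arg_min:
  assumes "is_arg_min (horizon_cost f l Vf k x) (\<lambda>u. u \<in> {..<k} \<rightarrow>\<^sub>E U) u"
  shows "value_fun U f l Vf k x = horizon_cost f l Vf k x u"
  unfolding value_fun_def
  using assms by (intro cInf_eq_minimum) (auto simp: is_arg_min_def not_less)

lemma arg_min_horizon_one:
  assumes "is_arg_min (horizon_cost f l Vf 1 x) (\<lambda>u. u \<in> {..<1} \<rightarrow>\<^sub>E U) u"
  shows "is_arg_min (\<lambda>v. Vf (f x v) + l x v) (\<lambda>v. v \<in> U) (u 0)"
  unfolding is_arg_min_linorder
proof (intro conjI allI impI)
  show "u 0 \<in> U"
    using assms by (auto simp: is_arg_min_def dest: PiE_mem)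
next
  fix v assume "v \<in> U"
  \<comment> \<open>Extensionality forces the value \<open>undefined\<close> at every index but 0.\<close>
  define w where "w = (\<lambda>j::nat. if j = 0 then v else undefined)"
  have "w \<in> {..<1} \<rightarrow>\<^sub>E U"
    using \<open>v \<in> U\<close> by (auto simp: w_def PiE_def extensional_def)
  then have "horizon_cost f l Vf 1 x u \<le> horizon_cost f l Vf 1 x w"
    using assms by (auto simp: is_arg_min_linorder)
  then show "Vf (f x (u 0)) + l x (u 0) \<le> Vf (f x v) + l x v"
    unfolding horizon_cost_one by (simp add: w_def)
qed

lemma one_step_bound_if_value_bound:
  assumes "minimizers_exist U f l Vf"
    and bound: "\<And>x. value_fun U f l Vf 1 x \<le> (1 + \<epsilon>) * Vf x"
  shows "one_step_bound U f l Vf \<epsilon>"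
  unfolding one_step_bound_def
proof
  fix x
  obtain u where u: "is_arg_min (horizon_cost f l Vf 1 x) (\<lambda>u. u \<in> {..<1} \<rightarrow>\<^sub>E U) u"
    using assms(1) unfolding minimizers_exist_def by blast
  have "Vf (f x (u 0)) + l x (u 0) \<le> (1 + \<epsilon>) * Vf x"
    using bound[of x] unfolding value_fun_eq_arg_min[OF u] horizon_cost_one .
  with arg_min_horizon_one[OF u]
  show "\<exists>v. is_arg_min (\<lambda>v. Vf (f x v) + l x v) (\<lambda>v. v \<in> U) v \<and>
            Vf (f x v) + l x v \<le> (1 + \<epsilon>) * Vf x"
    by blast
qed

theorem proposition2:
  fixes U :: "(real ^ 'm) set"
    and f :: "real ^ 'n \<Rightarrow> real ^ 'm \<Rightarrow> real ^ 'n"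
    and l :: "real ^ 'n \<Rightarrow> real ^ 'm \<Rightarrow> real"
    and \<sigma> Vf :: "real ^ 'n \<Rightarrow> real"
    and \<omega> \<gamma>bar \<epsilon> :: real
    and \<gamma> :: "nat \<Rightarrow> real"
  assumes l_nonneg: "\<forall>x. \<forall>u\<in>U. 0 \<le> l x u"
    and \<sigma>_nonneg: "\<forall>x. 0 \<le> \<sigma> x"
    and \<omega>_pos: "0 < \<omega>"
    and Vf_eq: "\<forall>x. Vf x = \<omega> * \<sigma> x"
    and minimizers: "minimizers_exist U f l Vf"
    and \<gamma>bar_nonneg: "0 \<le> \<gamma>bar"
    and \<gamma>_range: "\<forall>k\<ge>1. \<gamma> k \<in> {0..\<gamma>bar}"
    and value_bound: "\<forall>k\<ge>1. \<forall>x. value_fun U f l Vf k x \<le> \<gamma> k * \<sigma> x"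
    and \<epsilon>_eq: "1 + \<epsilon> = \<gamma> 1 / \<omega>"
  shows "(\<omega> < \<gamma> 1 \<longrightarrow> terminal_cost_condition U f l \<sigma> Vf (\<gamma> 1) \<omega> \<omega> \<epsilon>) \<and>
         (\<forall>x. \<omega> * \<sigma> x \<le> Vf x \<and> Vf x \<le> \<omega> * \<sigma> x) \<and>
         one_step_bound U f l Vf \<epsilon> \<and>
         (0 < \<gamma> 1 \<longrightarrow> \<omega> \<le> \<gamma> 1 / (1 + \<epsilon>) \<and> \<gamma> 1 / (1 + \<epsilon>) \<le> \<omega>)"
proof -
  have sandwich: "\<forall>x. \<omega> * \<sigma> x \<le> Vf x \<and> Vf x \<le> \<omega> * \<sigma> x"
    using Vf_eq by simp
  have "(1 + \<epsilon>) * Vf x = \<gamma> 1 * \<sigma> x" for x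
    using Vf_eq \<epsilon>_eq \<omega>_pos by simp
  then have step: "one_step_bound U f l Vf \<epsilon>"
    using minimizers value_bound by (intro one_step_bound_if_value_bound) auto
  have ratio: "\<gamma> 1 / (1 + \<epsilon>) = \<omega>" if "0 < \<gamma> 1"
    using that \<epsilon>_eq by simp
  have "0 < \<epsilon>" if "\<omega> < \<gamma> 1"
  proof -
    have "1 < \<gamma> 1 / \<omega>"
      using that \<omega>_pos by simp
    then show ?thesis
      using \<epsilon>_eq by linarith
  qed
  then show ?thesis
    using sandwich step ratio \<omega>_pos unfolding terminal_cost_condition_def by auto
qed

end
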